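(* Let $\lambda\in(0,\frac12)$ and $\gamma\in(0,1)$. Then $\alpha_2(\lambda,\gamma)\ge\alpha_r(\lambda,\gamma)$ if $\lambda\in\left[\frac{5+\gamma-2\sqrt{4+2\gamma}}{9+2\gamma+\gamma^2},\frac12\right)$, and $\alpha_2(\lambda,\gamma)\le\alpha_r(\lambda,\gamma)$ if $\lambda\in\left(0,\frac{5+\gamma-2\sqrt{4+2\gamma}}{9+2\gamma+\gamma^2}\right)$.
   Context: For $\lambda\in(0,1)$ and $\gamma\in(0,1)$ with $\lambda(1+\gamma)<1$, a real polynomial $p$ is said to be $(\lambda,\gamma)$-admissible if: (i) $p(\lambda)=0$; (ii) for all $x\in[0,(1-\gamma)\lambda]$, $-1\le p(x)\le p((1-\gamma)\lambda)<0$; and (iii) for all $x\in[(1+\gamma)\lambda,1]$, $0<p((1+\gamma)\lambda)\le p(x)\le 1$. The $(\lambda,\gamma)$-admissible gap of a $(\lambda,\gamma)$-admissible polynomial $p$ is $\alpha(p;\lambda,\gamma)=\min\{-p((1-\gamma)\lambda),\,p((1+\gamma)\lambda)\}$. The optimal gap $\alpha_2(\lambda,\gamma)$ is the maximum of $\alpha(p;\lambda,\gamma)$ over all $(\lambda,\gamma)$-admissible polynomials $p$ of degree $2$. With the ridge regression function $r_\lambda(x)=\frac{x}{x+\lambda}$, one sets $\alpha_r(\lambda,\gamma)=\min\{1-2r_\lambda((1-\gamma)\lambda),\,2r_\lambda((1+\gamma)\lambda)-1\}=\frac{\gamma}{2+\gamma}$. *)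

theory Defs
  imports Complex_Main "HOL-Computational_Algebra.Polynomial"
begin

text \<open>Standing assumptions on the parameters:
  \<open>0 < lam < 1\<close>, \<open>0 < gam < 1\<close> and \<open>lam * (1 + gam) < 1\<close>.\<close>

definition admissible :: "real \<Rightarrow> real \<Rightarrow> real poly \<Rightarrow> bool" where
  "admissible lam gam p \<longleftrightarrow>
     poly p lam = 0 \<and>
     (\<forall>x \<in> {0..(1 - gam) * lam}.
        -1 \<le> poly p x \<and> poly p x \<le> poly p ((1 - gam) * lam) \<and> poly p ((1 - gam) * lam) < 0) \<and>
     (\<forall>x \<in> {(1 + gam) * lam..1}.
        0 < poly p ((1 + gam) * lam) \<and> poly p ((1 + gam) * lam) \<le> poly p x \<and> poly p x \<le> 1)"

definition admissible_gap :: "real poly \<Rightarrow> real \<Rightarrow> real \<Rightarrow> real" where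
  "admissible_gap p lam gam = min (- poly p ((1 - gam) * lam)) (poly p ((1 + gam) * lam))"

text \<open>The optimal gap is a maximum rather than a supremum: \<open>GREATEST\<close> has a specified value only
  when the greatest value is attained. The degree is exactly 2.\<close>

definition alpha2 :: "real \<Rightarrow> real \<Rightarrow> real" where
  "alpha2 lam gam =
     (GREATEST a. \<exists>p. degree p = 2 \<and> admissible lam gam p \<and> a = admissible_gap p lam gam)"

definition ridge :: "real \<Rightarrow> real \<Rightarrow> real" where
  "ridge lam x = x / (x + lam)"

definition alpha_r :: "real \<Rightarrow> real \<Rightarrow> real" where
  "alpha_r lam gam =
     min (1 - 2 * ridge lam ((1 - gam) * lam)) (2 * ridge lam ((1 + gam) * lam) - 1)"

lemma alpha_r_eq:
  assumes "0 < lam" "0 < gam" "gam < 1"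
  shows "alpha_r lam gam = gam / (2 + gam)"
proof -
  have l: "ridge lam (c * lam) = c / (c + 1)" if "c > 0" for c
  proof -
    have "ridge lam (c * lam) = (c * lam) / ((c + 1) * lam)"
      unfolding ridge_def by (simp add: algebra_simps)
    then show ?thesis using assms(1) by simp
  qed
  have a: "1 - 2 * ridge lam ((1 - gam) * lam) = gam / (2 - gam)"
    using assms by (subst l) (auto simp: field_simps)
  have b: "2 * ridge lam ((1 + gam) * lam) - 1 = gam / (2 + gam)"
    using assms by (subst l) (auto simp: field_simps)
  have "gam / (2 + gam) \<le> gam / (2 - gam)"
    using assms by (intro divide_left_mono) auto
  then show ?thesis unfolding alpha_r_def a b by simp
qed

end

theory Submission
  imports Defs
begin

text \<open>
  Write a quadratic vanishing at \<open>\<lambda>\<close> as \<open>b y - a y\<^sup>2\<close> with \<open>y = x - \<lambda>\<close>, and put \<open>d = \<gamma> \<lambda>\<close>. The gap is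
  \<open>b d - \<bar>a\<bar> d\<^sup>2\<close>, a concave function of \<open>(a, b)\<close>, and it is enough to bound \<open>b d - a d\<^sup>2\<close> by linear
  programming: admissibility at \<open>x = 0\<close> gives \<open>b \<lambda> + a \<lambda>\<^sup>2 \<le> 1\<close>, the comparison of \<open>x = 1\<close> with
  \<open>x = (1 + \<gamma>) \<lambda>\<close> gives \<open>b \<ge> a (d + 1 - \<lambda>)\<close>, and the upper bound at \<open>y = 1 / s\<close> gives
  \<open>b \<le> s + a / s\<close>. The optimum lies where two of these are tight, for a suitable \<open>s\<close>: at
  \<open>s = 2 / (d + 1 - \<lambda>)\<close> for small \<open>\<lambda>\<close>, at \<open>s = (\<surd>2 - 1) / \<lambda>\<close> for intermediate \<open>\<lambda>\<close>, and at
  \<open>s = 1 / (1 - \<lambda>)\<close> for \<open>\<lambda>\<close> close to \<open>1/2\<close>. The threshold of the theorem lies in the first regime.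
\<close>

section \<open>Admissible quadratics in the coordinates \<open>a\<close>, \<open>b\<close>\<close>

lemma degree_2_root_expansion:
  fixes p :: "real poly"
  assumes "degree p = 2" "poly p l = 0"
  obtains a b where "\<And>x. poly p x = b * (x - l) - a * (x - l)\<^sup>2"
proof -
  have e: "poly p x = coeff p 0 + coeff p 1 * x + coeff p 2 * x\<^sup>2" for x
    using assms(1) by (simp add: poly_altdef numeral_2_eq_2)
  have "poly p x = (coeff p 1 + 2 * coeff p 2 * l) * (x - l) - (- coeff p 2) * (x - l)\<^sup>2" for x
  proof -
    have "poly p x = poly p x - poly p l" using assms by simp
    also have "\<dots> = (coeff p 1 + 2 * coeff p 2 * l) * (x - l) - (- coeff p 2) * (x - l)\<^sup>2"
      unfolding e by (simp add: algebra_simps power2_eq_square)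
    finally show ?thesis .
  qed
  then show ?thesis by (rule that)
qed

text \<open>Necessary conditions, linear in \<open>(a, b)\<close>, with no sign imposed on
  \<open>a\<close>, so that convex competitors are covered as well. Bounding the gap by its
  right-hand value alone is enough for upper bounds.\<close>

lemma admissible_degree_2_bounds:
  assumes lam: "0 < lam" and gam: "0 < gam" "gam < 1" and lt: "lam * (1 + gam) < 1"
    and p: "degree p = 2" "admissible lam gam p"
  obtains a b where
    "b * lam + a * lam\<^sup>2 \<le> 1"
    "a * (gam * lam + (1 - lam)) \<le> b"
    "\<And>y. gam * lam \<le> y \<Longrightarrow> y \<le> 1 - lam \<Longrightarrow> b * y - a * y\<^sup>2 \<le> 1"
    "admissible_gap p lam gam \<le> b * (gam * lam) - a * (gam * lam)\<^sup>2"
proof -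
  have "poly p lam = 0" using p(2) by (simp add: admissible_def)
  then obtain a b where e: "\<And>x. poly p x = b * (x - lam) - a * (x - lam)\<^sup>2"
    using degree_2_root_expansion[OF p(1)] by metis
  have en: "(1 + gam) * lam - lam = gam * lam" by (simp add: algebra_simps)
  have "0 \<in> {0..(1 - gam) * lam}" using lam gam by simp
  then have "- 1 \<le> poly p 0" using p(2) unfolding admissible_def by blast
  then have 1: "b * lam + a * lam\<^sup>2 \<le> 1" by (simp add: e)
  have "1 \<in> {(1 + gam) * lam..1}" using lt by (simp add: mult.commute)
  then have "poly p ((1 + gam) * lam) \<le> poly p 1" using p(2) unfolding admissible_def by blast
  \<comment> \<open>The difference of the two values factors, since both are taken by the same
    quadratic without constant term in \<open>x - lam\<close>.\<close>
  then have "0 \<le> (1 - lam - gam * lam) * (b - a * (gam * lam + (1 - lam)))"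
    unfolding e en by (simp add: algebra_simps power2_eq_square)
  moreover have "0 < 1 - lam - gam * lam" using lt by (simp add: algebra_simps)
  ultimately have 2: "a * (gam * lam + (1 - lam)) \<le> b" by (simp add: zero_le_mult_iff)
  have 3: "b * y - a * y\<^sup>2 \<le> 1" if "gam * lam \<le> y" "y \<le> 1 - lam" for y
  proof -
    have "y + lam \<in> {(1 + gam) * lam..1}" using that by (simp add: algebra_simps)
    then have "poly p (y + lam) \<le> 1" using p(2) unfolding admissible_def by blast
    then show ?thesis by (simp add: e)
  qed
  have "admissible_gap p lam gam \<le> poly p ((1 + gam) * lam)" by (simp add: admissible_gap_def)
  then have 4: "admissible_gap p lam gam \<le> b * (gam * lam) - a * (gam * lam)\<^sup>2"
    unfolding e en .
  show ?thesis using 1 2 3 4 by (rule that)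
qed

text \<open>For \<open>a > 0\<close> the necessary conditions are also sufficient: left of
  \<open>lam\<close> both terms of the polynomial are monotone, and right of it a concave function
  is smallest at an end of the interval. Concavity also makes the right-hand value the smaller one
  in the gap.\<close>

lemma admissible_degree_2_exists:
  assumes lam: "0 < lam" and gam: "0 < gam" "gam < 1" and lt: "lam * (1 + gam) < 1"
    and a: "0 < a"
    and 1: "b * lam + a * lam\<^sup>2 \<le> 1"
    and 2: "a * (gam * lam + (1 - lam)) \<le> b"
    and 3: "\<And>y. gam * lam \<le> y \<Longrightarrow> y \<le> 1 - lam \<Longrightarrow> b * y - a * y\<^sup>2 \<le> 1"
  obtains p where "degree p = 2" "admissible lam gam p"
    "admissible_gap p lam gam = b * (gam * lam) - a * (gam * lam)\<^sup>2"
proof -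
  define d where "d = gam * lam"
  define p where "p = [:- lam, 1:] * [:b + a * lam, - a:]"
  have e: "poly p x = b * (x - lam) - a * (x - lam)\<^sup>2" for x
    by (simp add: p_def algebra_simps power2_eq_square)
  have deg: "degree p = 2"
    unfolding p_def using a by (subst degree_mult_eq) auto
  have d: "0 < d" "d < lam" "d < 1 - lam"
    using lam gam lt by (auto simp: d_def algebra_simps)
  have b: "a * d < b"
  proof -
    have "a * d < a * (d + (1 - lam))" using a d by (intro mult_strict_left_mono) auto
    also have "\<dots> \<le> b" using 2 by (simp add: d_def)
    finally show ?thesis .
  qed
  have "0 < b" using b a d(1) by (meson mult_pos_pos order.strict_trans)
  have vm: "poly p ((1 - gam) * lam) = - b * d - a * d\<^sup>2"
    by (simp add: e d_def algebra_simps)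
  have vp: "poly p ((1 + gam) * lam) = b * d - a * d\<^sup>2"
    by (simp add: e d_def algebra_simps)
  have "- b * d - a * d\<^sup>2 < 0" using \<open>0 < b\<close> a d
    by (smt (verit) mult_minus_left mult_pos_pos zero_less_power)
  moreover have "- 1 \<le> poly p x \<and> poly p x \<le> - b * d - a * d\<^sup>2"
    if "0 \<le> x" "x \<le> (1 - gam) * lam" for x
  proof -
    define y where "y = lam - x"
    have y: "d \<le> y" "y \<le> lam" using that by (auto simp: y_def d_def algebra_simps)
    have "poly p x = - b * y - a * y\<^sup>2" by (simp add: e y_def algebra_simps power2_eq_square)
    moreover have "b * d \<le> b * y" "b * y \<le> b * lam" using y \<open>0 < b\<close> by auto
    moreover have "a * d\<^sup>2 \<le> a * y\<^sup>2" "a * y\<^sup>2 \<le> a * lam\<^sup>2" using y a d by (auto intro!: power_mono)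
    ultimately show ?thesis using 1 by simp
  qed
  moreover have "0 < b * d - a * d\<^sup>2"
    using mult_strict_right_mono[OF b d(1)] by (simp add: power2_eq_square)
  moreover have "b * d - a * d\<^sup>2 \<le> poly p x \<and> poly p x \<le> 1"
    if "(1 + gam) * lam \<le> x" "x \<le> 1" for x
  proof -
    define y where "y = x - lam"
    have y: "d \<le> y" "y \<le> 1 - lam" using that by (auto simp: y_def d_def algebra_simps)
    \<comment> \<open>The rise from \<open>d\<close> to \<open>y\<close> is
      \<open>(y - d) * (b - a * (y + d))\<close>; its second factor is smallest at
      \<open>y = 1 - lam\<close>, where hypothesis 2 applies.\<close>
    have "a * (y + d) \<le> a * (d + (1 - lam))" using a y by simp
    then have "0 \<le> (y - d) * (b - a * (y + d))" using y 2 by (simp add: d_def)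
    then show ?thesis using 3[of y] y unfolding e y_def[symmetric]
      by (simp add: d_def algebra_simps power2_eq_square)
  qed
  ultimately have "admissible lam gam p" unfolding admissible_def vm vp by (simp add: e)
  moreover have "admissible_gap p lam gam = b * (gam * lam) - a * (gam * lam)\<^sup>2"
    unfolding admissible_gap_def vm vp using a d by (simp add: d_def)
  ultimately show ?thesis using deg that by blast
qed

section \<open>The optimal gap in the three ranges of \<open>lam\<close>\<close>

lemma alpha2_eqI:
  assumes "degree p = 2" "admissible lam gam p" "admissible_gap p lam gam = g"
    and "\<And>q. degree q = 2 \<Longrightarrow> admissible lam gam q \<Longrightarrow> admissible_gap q lam gam \<le> g"
  shows "alpha2 lam gam = g"
  unfolding alpha2_def using assms by (intro Greatest_equality) auto

lemma two_mul_minus_square_le_1: "2 * s * y - s\<^sup>2 * y\<^sup>2 \<le> (1::real)"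
  using zero_le_power2[of "1 - s * y"] by (simp add: power2_eq_square algebra_simps)

text \<open>The optimum is \<open>1 - (1 - s * y)^2\<close>, whose peak \<open>1 / s\<close> is the
  midpoint of \<open>[d, 1 - lam]\<close>, so that its values at both ends agree. \<open>reg\<close>
  says that the value at \<open>x = 0\<close> stays above -1.\<close>

lemma alpha2_small_lam:
  assumes lam: "0 < lam" and gam: "0 < gam" "gam < 1" and lt: "lam * (1 + gam) < 1"
    and s: "s = 2 / (gam * lam + (1 - lam))"
    and reg: "2 * (s * lam) + (s * lam)\<^sup>2 \<le> 1"
  shows "alpha2 lam gam = 1 - (1 - s * (gam * lam))\<^sup>2"
proof -
  define d where "d = gam * lam"
  have d: "0 < d" "d < lam" "d < 1 - lam"
    using lam gam lt by (auto simp: d_def algebra_simps)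
  have "0 < d + (1 - lam)" using d by simp
  then have s0: "0 < s" and s1: "s * (d + (1 - lam)) = 2"
    unfolding s d_def[symmetric] by (auto simp del: distrib_left_numeral)
  have inv: "1 / s = (d + (1 - lam)) / 2" by (simp add: s d_def)
  then have is1: "d \<le> 1 / s" "1 / s \<le> 1 - lam" using d by auto
  have g: "2 * s * d - s\<^sup>2 * d\<^sup>2 = 1 - (1 - s * d)\<^sup>2"
    by (simp add: power2_eq_square algebra_simps)
  obtain p where p: "degree p = 2" "admissible lam gam p"
      "admissible_gap p lam gam = 2 * s * d - s\<^sup>2 * d\<^sup>2"
  proof (rule admissible_degree_2_exists[OF lam gam lt, of "s\<^sup>2" "2 * s"])
    show "0 < s\<^sup>2" using s0 by simp
    show "2 * s * lam + s\<^sup>2 * lam\<^sup>2 \<le> 1" using reg by (simp add: power_mult_distrib)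
    show "s\<^sup>2 * (gam * lam + (1 - lam)) \<le> 2 * s"
      using s1 by (simp add: d_def power2_eq_square mult.assoc)
  qed (use two_mul_minus_square_le_1 d_def in auto)
  have "admissible_gap q lam gam \<le> 2 * s * d - s\<^sup>2 * d\<^sup>2"
    if q: "degree q = 2" "admissible lam gam q" for q
  proof -
    obtain a b where 2: "a * (d + (1 - lam)) \<le> b"
      and 3: "\<And>y. d \<le> y \<Longrightarrow> y \<le> 1 - lam \<Longrightarrow> b * y - a * y\<^sup>2 \<le> 1"
      and 4: "admissible_gap q lam gam \<le> b * d - a * d\<^sup>2"
      using admissible_degree_2_bounds[OF lam gam lt q] unfolding d_def by metis
    have b: "b \<le> s + a / s"
      using 3[OF is1] s0 by (simp add: field_simps power2_eq_square)
    have "2 / s = d + (1 - lam)" by (simp add: s d_def)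
    then have "a * (2 / s) \<le> b" using 2 by (simp only:)
    moreover have "a * (2 / s) = a / s + a / s" by simp
    ultimately have "a / s \<le> s" using b by linarith
    then have a: "a \<le> s\<^sup>2" using s0 by (simp add: field_simps power2_eq_square)
    \<comment> \<open>Once \<open>b\<close> is eliminated the bound increases with \<open>a\<close>,
      because \<open>d \<le> 1 / s\<close>; hence \<open>a = s^2\<close> is the worst case.\<close>
    have "b * d \<le> (s + a / s) * d" using b d by simp
    then have "b * d - a * d\<^sup>2 \<le> s * d + a * (d * (1 / s - d))"
      by (simp add: algebra_simps power2_eq_square)
    also have "\<dots> \<le> s * d + s\<^sup>2 * (d * (1 / s - d))"
      using a d is1 by (intro add_left_mono mult_right_mono) auto
    also have "\<dots> = 2 * s * d - s\<^sup>2 * d\<^sup>2"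
      using s0 by (simp add: field_simps power2_eq_square)
    finally show ?thesis using 4 by simp
  qed
  then show ?thesis using alpha2_eqI[OF p] g unfolding d_def by simp
qed

text \<open>Covers both regimes in which the constraint at \<open>x = 0\<close> is tight: \<open>(a, b)\<close> is the vertex
  cut out by \<open>b = s + a / s\<close> and \<open>b \<lambda> + a \<lambda>\<^sup>2 = 1\<close>.\<close>

lemma alpha2_vertex:
  assumes lam: "0 < lam" and gam: "0 < gam" "gam < 1" and lt: "lam * (1 + gam) < 1"
    and s: "0 < s" "gam * lam \<le> 1 / s" "1 / s \<le> 1 - lam"
    and a: "0 < a" "b = s + a / s" "b * lam + a * lam\<^sup>2 = 1"
      "a * (gam * lam + (1 - lam)) \<le> b"
      "\<And>y. gam * lam \<le> y \<Longrightarrow> y \<le> 1 - lam \<Longrightarrow> b * y - a * y\<^sup>2 \<le> 1"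
  shows "alpha2 lam gam = b * (gam * lam) - a * (gam * lam)\<^sup>2"
proof -
  define d where "d = gam * lam"
  have d: "0 < d" using lam gam by (simp add: d_def)
  obtain p where p: "degree p = 2" "admissible lam gam p"
      "admissible_gap p lam gam = b * (gam * lam) - a * (gam * lam)\<^sup>2"
    using admissible_degree_2_exists[OF lam gam lt a(1) _ a(4) a(5)] a(3) by force
  have "admissible_gap q lam gam \<le> b * d - a * d\<^sup>2"
    if q: "degree q = 2" "admissible lam gam q" for q
  proof -
    obtain a' b' where 1: "b' * lam + a' * lam\<^sup>2 \<le> 1"
      and 3: "\<And>y. d \<le> y \<Longrightarrow> y \<le> 1 - lam \<Longrightarrow> b' * y - a' * y\<^sup>2 \<le> 1"
      and 4: "admissible_gap q lam gam \<le> b' * d - a' * d\<^sup>2"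
      using admissible_degree_2_bounds[OF lam gam lt q] unfolding d_def by metis
    have b': "b' \<le> s + a' / s"
      using 3[of "1 / s"] s unfolding d_def by (simp add: field_simps power2_eq_square)
    \<comment> \<open>Each side of the vertex is controlled by one constraint: for
      \<open>a' \<le> a\<close> the bound at \<open>1 / s\<close>, whose slope is at least
      \<open>d\<close>; for \<open>a' > a\<close> the bound at \<open>x = 0\<close>, which forces
      \<open>b'\<close> below \<open>b\<close>.\<close>
    have "b' * d - a' * d\<^sup>2 \<le> b * d - a * d\<^sup>2"
    proof (cases "a' \<le> a")
      case True
      have "b' - b \<le> (a' - a) * (1 / s)" using b' a(2) by (simp add: diff_divide_distrib)
      also have "\<dots> \<le> (a' - a) * d"
        using True s(2) by (intro mult_left_mono_neg) (auto simp: d_def)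
      finally have "(b' - b) * d \<le> (a' - a) * d * d" using d by (intro mult_right_mono) auto
      then show ?thesis by (simp add: algebra_simps power2_eq_square)
    next
      case False
      have "lam * (b' - b) \<le> lam * (lam * (a - a'))"
        using 1 a(3) by (simp add: algebra_simps power2_eq_square)
      then have "b' - b \<le> lam * (a - a')" using lam by simp
      also have "\<dots> \<le> 0" using False lam by (simp add: mult_nonneg_nonpos)
      finally have "b' * d \<le> b * d" using d by simp
      moreover have "a * d\<^sup>2 \<le> a' * d\<^sup>2" using False by (intro mult_right_mono) auto
      ultimately show ?thesis by simp
    qed
    then show ?thesis using 4 by simp
  qed
  then show ?thesis using alpha2_eqI[OF p] unfolding d_def by simp
qed

text \<open>Again \<open>1 - (1 - s * y)^2\<close>, now with \<open>s = w / lam\<close>: the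
  equation for \<open>w\<close> is \<open>(1 + w)^2 = 2\<close>, which makes the value at
  \<open>x = 0\<close> exactly -1. \<open>reg\<close> places the peak \<open>lam / w\<close> in the
  right half of \<open>[d, 1 - lam]\<close>.\<close>

lemma alpha2_intermediate_lam:
  assumes lam: "0 < lam" and gam: "0 < gam" "gam < 1" and lt: "lam * (1 + gam) < 1"
    and w: "0 < w" "w\<^sup>2 + 2 * w = 1"
    and reg: "w * (gam * lam + (1 - lam)) \<le> 2 * lam" "lam \<le> w * (1 - lam)"
  shows "alpha2 lam gam = 2 * (w * gam) - (w * gam)\<^sup>2"
proof -
  define s where "s = w / lam"
  have s0: "0 < s" using w lam by (simp add: s_def)
  have w1: "w < 1" using w by (smt (verit) zero_less_power)
  have "alpha2 lam gam = 2 * s * (gam * lam) - s\<^sup>2 * (gam * lam)\<^sup>2"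
  proof (rule alpha2_vertex[OF lam gam lt s0])
    have "w * gam \<le> 1" using w1 gam w by (simp add: mult_le_one)
    then show "gam * lam \<le> 1 / s"
      using lam w by (simp add: s_def field_simps)
    show "1 / s \<le> 1 - lam" using reg(2) w by (simp add: s_def field_simps)
    show "0 < s\<^sup>2" using s0 by simp
    show "2 * s = s + s\<^sup>2 / s" using s0 by (simp add: power2_eq_square)
    show "2 * s * lam + s\<^sup>2 * lam\<^sup>2 = 1" using w(2) lam by (simp add: s_def power_divide)
    have "s * (gam * lam + (1 - lam)) \<le> 2" using reg(1) lam by (simp add: s_def field_simps)
    then show "s\<^sup>2 * (gam * lam + (1 - lam)) \<le> 2 * s"
      using s0 by (simp add: power2_eq_square mult.assoc)
  qed (rule two_mul_minus_square_le_1)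
  also have "\<dots> = 2 * (w * gam) - (w * gam)\<^sup>2"
    using lam by (simp add: s_def field_simps power2_eq_square)
  finally show ?thesis .
qed

text \<open>The optimum is the quadratic through \<open>(0, -1)\<close>, \<open>(lam, 0)\<close> and
  \<open>(1, 1)\<close>. \<open>reg\<close> puts its peak at or beyond \<open>x = 1\<close>, so the
  upper bound 1 is tight at the end of the interval.\<close>

lemma alpha2_large_lam:
  assumes lam: "0 < lam" "lam < 1/2" and gam: "0 < gam" "gam < 1"
    and reg: "1 - 4 * lam + 2 * lam\<^sup>2 \<le> 0"
  shows "alpha2 lam gam = gam * (1 - (1 + gam) * (lam * (1 - 2 * lam) / (1 - lam)))"
proof -
  define L where "L = 1 - lam"
  define a where "a = (1 - 2 * lam) / (lam * L)"
  define b where "b = 1 / L + a * L"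
  have L: "0 < L" "lam < L" using lam by (auto simp: L_def)
  have a0: "0 < a" using lam L by (simp add: a_def)
  have d: "gam * lam < lam" using lam gam by simp
  have "lam * (1 + gam) = lam + gam * lam" by (simp add: algebra_simps)
  then have lt: "lam * (1 + gam) < 1" using d lam by linarith
  have al: "a * lam * L = 1 - 2 * lam" using lam L by (simp add: a_def)
  have tight: "b * lam + a * lam\<^sup>2 = 1"
  proof -
    have "b * lam + a * lam\<^sup>2 = lam / L + a * lam * (L + lam)"
      by (simp add: b_def algebra_simps power2_eq_square)
    also have "\<dots> = lam / L + a * lam * L / L" using L by (simp add: L_def)
    also have "\<dots> = (lam + (1 - 2 * lam)) / L" by (simp add: al add_divide_distrib[symmetric])
    also have "\<dots> = 1" using L by (simp add: L_def)
    finally show ?thesis .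
  qed
  have "a * L * L \<le> 1"
  proof -
    have "a * L * L = (1 - 2 * lam) * L / lam" using L lam by (simp add: a_def)
    also have "\<dots> \<le> 1" using reg lam by (simp add: L_def field_simps power2_eq_square)
    finally show ?thesis .
  qed
  then have "a * L \<le> 1 / L" using L by (simp add: field_simps)
  then have b: "2 * a * L \<le> b" unfolding b_def by linarith
  have step: "a * (y + L) \<le> b" if "y \<le> L" for y
  proof -
    have "a * (y + L) \<le> a * (L + L)" using that a0 by (intro mult_left_mono) auto
    then show ?thesis using b by (simp add: algebra_simps)
  qed
  have bL: "b * L - a * L\<^sup>2 = 1" using L by (simp add: b_def algebra_simps power2_eq_square)
  have "alpha2 lam gam = b * (gam * lam) - a * (gam * lam)\<^sup>2"
  proof (rule alpha2_vertex[OF lam(1) gam lt, of "1 / L"])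
    show "0 < 1 / L" "gam * lam \<le> 1 / (1 / L)" "1 / (1 / L) \<le> 1 - lam"
      using L d by (auto simp: L_def)
    show "b = 1 / L + a / (1 / L)" by (simp add: b_def)
    show "a * (gam * lam + (1 - lam)) \<le> b" using step[of "gam * lam"] d L by (simp add: L_def)
    show "b * y - a * y\<^sup>2 \<le> 1" if "gam * lam \<le> y" "y \<le> 1 - lam" for y
    proof -
      have "0 \<le> (L - y) * (b - a * (y + L))" using step[of y] that by (simp add: L_def)
      then show ?thesis using bL by (simp add: algebra_simps power2_eq_square)
    qed
  qed (use a0 tight in auto)
  also have "\<dots> = gam * (b * lam) - gam\<^sup>2 * (a * lam\<^sup>2)"
    by (simp add: algebra_simps power2_eq_square)
  also have "\<dots> = gam * (1 - (1 + gam) * (a * lam\<^sup>2))"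
  proof -
    have "b * lam = 1 - a * lam\<^sup>2" using tight by simp
    then show ?thesis by (simp only:) (simp add: algebra_simps power2_eq_square)
  qed
  also have "a * lam\<^sup>2 = lam * (1 - 2 * lam) / (1 - lam)"
    using lam L by (simp add: a_def L_def power2_eq_square)
  finally show ?thesis .
qed

section \<open>The threshold and the comparison with the ridge gap\<close>

text \<open>The parameter \<open>t = \<surd>(2 / (2 + \<gamma>))\<close> rationalises the threshold and makes the ridge gap equal to
  \<open>1 - t\<^sup>2\<close>, so that comparing it with \<open>1 - (1 - s d)\<^sup>2\<close> amounts to comparing \<open>1 - s d\<close> with \<open>t\<close>.\<close>

lemma threshold_eq:
  fixes t gam :: real
  assumes t: "0 < t" and gam: "gam = 2 / t\<^sup>2 - 2"
  shows "(5 + gam - 2 * sqrt (4 + 2 * gam)) / (9 + 2 * gam + gam\<^sup>2)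
    = t\<^sup>2 / (3 * t\<^sup>2 + 4 * t + 2)"
proof -
  have "4 + 2 * gam = (2 / t)\<^sup>2" by (simp add: gam power_divide)
  then have sq: "sqrt (4 + 2 * gam) = 2 / t" using t by simp
  have n: "0 < 3 * t\<^sup>2 - 4 * t + 2"
  proof -
    have "3 * t\<^sup>2 - 4 * t + 2 = 2 * (t - 1)\<^sup>2 + t\<^sup>2" by (simp add: power2_eq_square algebra_simps)
    also have "\<dots> > 0" using t by (intro add_nonneg_pos) auto
    finally show ?thesis .
  qed
  have m: "0 < 3 * t\<^sup>2 + 4 * t + 2" using t by (simp add: add_pos_pos)
  have num: "5 + gam - 2 * sqrt (4 + 2 * gam) = (3 * t\<^sup>2 - 4 * t + 2) / t\<^sup>2"
    unfolding sq unfolding gam using t by (simp add: field_simps power2_eq_square)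
  \<comment> \<open>Up to the power of \<open>t\<close> this is
    \<open>(3 * t^2 + 2)^2 - (4 * t)^2\<close>; one factor cancels against the numerator.\<close>
  have den: "9 + 2 * gam + gam\<^sup>2 = (3 * t\<^sup>2 - 4 * t + 2) * (3 * t\<^sup>2 + 4 * t + 2) / (t\<^sup>2 * t\<^sup>2)"
    unfolding gam using t by (simp add: field_simps power2_eq_square)
  have c: "(N / q) / (N * M / (q * q)) = q / M" if "N \<noteq> 0" "q \<noteq> 0" for N M q :: real
    using that by simp
  show ?thesis unfolding num den using n t by (intro c) auto
qed

text \<open>Multiplying \<open>t - v\<close>, where \<open>v = 1 - s * d\<close>, by the positive
  \<open>t^2 * D\<close> gives an expression affine in \<open>lam\<close> with positive slope that
  vanishes exactly at the threshold.\<close>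

lemma small_lam_gap_threshold:
  fixes t gam lam :: real
  assumes t: "0 < t" and gam: "gam = 2 / t\<^sup>2 - 2" "0 < gam" "gam < 1"
    and lam: "0 < lam" "lam < 1/2"
    and s: "s = 2 / (gam * lam + (1 - lam))"
  shows "t\<^sup>2 / (3 * t\<^sup>2 + 4 * t + 2) \<le> lam \<longleftrightarrow> gam / (2 + gam) \<le> 1 - (1 - s * (gam * lam))\<^sup>2"
    and "lam \<le> t\<^sup>2 / (3 * t\<^sup>2 + 4 * t + 2) \<longleftrightarrow> 1 - (1 - s * (gam * lam))\<^sup>2 \<le> gam / (2 + gam)"
proof -
  define D where "D = gam * lam + (1 - lam)"
  have d: "0 < gam * lam" "gam * lam < lam" using gam lam by auto
  have D: "0 < D" using d lam by (simp add: D_def)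
  have t1: "t < 1"
  proof -
    have "gam * t\<^sup>2 + 2 * t\<^sup>2 = 2" using gam(1) t by (simp add: field_simps)
    moreover have "0 < gam * t\<^sup>2" using gam(2) t by simp
    ultimately have "t\<^sup>2 < 1" by linarith
    then show ?thesis using t by (simp add: power_less_one_iff abs_square_less_1)
  qed
  have "(2 + gam) * t\<^sup>2 = 2" using gam(1) t by (simp add: field_simps)
  then have r: "1 - gam / (2 + gam) = t\<^sup>2" using gam(2) by (simp add: field_simps)
  define v where "v = 1 - s * (gam * lam)"
  have "v = (D - 2 * (gam * lam)) / D"
    using D by (simp add: v_def s D_def[symmetric] diff_divide_distrib)
  then have v: "v = (1 - lam - gam * lam) / D" by (simp add: D_def)
  have v0: "0 \<le> v" unfolding v using D d lam by (intro divide_nonneg_pos) linarith+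
  have m: "0 < 3 * t\<^sup>2 + 4 * t + 2" using t by (simp add: add_pos_pos)
  have key: "t\<^sup>2 * D * (t - v) = (1 - t) * (lam * (3 * t\<^sup>2 + 4 * t + 2) - t\<^sup>2)"
  proof -
    have gt: "t\<^sup>2 * gam = 2 - 2 * t\<^sup>2" using gam(1) t by (simp add: field_simps)
    have "t\<^sup>2 * D * (t - v) = t * (lam * (t\<^sup>2 * gam) + t\<^sup>2 * (1 - lam)) - (t\<^sup>2 * (1 - lam) - lam * (t\<^sup>2 * gam))"
      unfolding v using D by (simp add: field_simps) (simp add: D_def algebra_simps)
    also have "\<dots> = (1 - t) * (lam * (3 * t\<^sup>2 + 4 * t + 2) - t\<^sup>2)"
      unfolding gt by (simp add: algebra_simps power2_eq_square)
    finally show ?thesis .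
  qed
  have sign_iff: "0 \<le> k * x \<longleftrightarrow> 0 \<le> x" "k * x \<le> 0 \<longleftrightarrow> x \<le> 0" if "0 < k" for k x :: real
    using that by (simp_all add: zero_le_mult_iff mult_le_0_iff)
  have "t\<^sup>2 / (3 * t\<^sup>2 + 4 * t + 2) \<le> lam \<longleftrightarrow> 0 \<le> t\<^sup>2 * D * (t - v)"
    unfolding key using m t1 by (simp add: zero_le_mult_iff pos_divide_le_eq)
  also have "\<dots> \<longleftrightarrow> v \<le> t" using sign_iff(1)[of "t\<^sup>2 * D" "t - v"] t D by simp
  also have "\<dots> \<longleftrightarrow> v\<^sup>2 \<le> t\<^sup>2" using v0 t by simp
  finally show "t\<^sup>2 / (3 * t\<^sup>2 + 4 * t + 2) \<le> lam \<longleftrightarrow> gam / (2 + gam) \<le> 1 - (1 - s * (gam * lam))\<^sup>2"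
    using r by (auto simp: v_def)
  have "lam \<le> t\<^sup>2 / (3 * t\<^sup>2 + 4 * t + 2) \<longleftrightarrow> t\<^sup>2 * D * (t - v) \<le> 0"
    unfolding key using m t1 by (simp add: mult_le_0_iff pos_le_divide_eq)
  also have "\<dots> \<longleftrightarrow> t \<le> v" using sign_iff(2)[of "t\<^sup>2 * D" "t - v"] t D by simp
  also have "\<dots> \<longleftrightarrow> t\<^sup>2 \<le> v\<^sup>2" using v0 t by simp
  finally show "lam \<le> t\<^sup>2 / (3 * t\<^sup>2 + 4 * t + 2) \<longleftrightarrow> 1 - (1 - s * (gam * lam))\<^sup>2 \<le> gam / (2 + gam)"
    using r by (auto simp: v_def)
qed

theorem proposition5:
  fixes lam gam :: real
  assumes "lam \<in> {0<..<1/2}" and "gam \<in> {0<..<1}"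
  shows "(lam \<in> {(5 + gam - 2 * sqrt (4 + 2 * gam)) / (9 + 2 * gam + gam^2)..<1/2} \<longrightarrow>
            alpha2 lam gam \<ge> alpha_r lam gam) \<and>
         (lam \<in> {0<..<(5 + gam - 2 * sqrt (4 + 2 * gam)) / (9 + 2 * gam + gam^2)} \<longrightarrow>
            alpha2 lam gam \<le> alpha_r lam gam)"
proof -
  have lam: "0 < lam" "lam < 1/2" and gam: "0 < gam" "gam < 1" using assms by auto
  have d: "0 < gam * lam" "gam * lam < lam" using gam lam by auto
  have "lam * (1 + gam) = lam + gam * lam" by (simp add: algebra_simps)
  then have lt: "lam * (1 + gam) < 1" using d lam by linarith
  define t where "t = sqrt (2 / (2 + gam))"
  define l0 where "l0 = t\<^sup>2 / (3 * t\<^sup>2 + 4 * t + 2)"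
  define s where "s = 2 / (gam * lam + (1 - lam))"
  define w where "w = sqrt 2 - (1::real)"
  have t: "0 < t" "t < 1" using gam by (auto simp: t_def)
  have "t\<^sup>2 = 2 / (2 + gam)" using gam by (simp add: t_def)
  then have gt: "gam = 2 / t\<^sup>2 - 2" using gam t by (simp add: field_simps)
  have w2: "w\<^sup>2 + 2 * w = 1" by (simp add: w_def power2_eq_square algebra_simps)
  have "7/5 < sqrt (2::real)" by (rule real_less_rsqrt) (simp add: power2_eq_square)
  moreover have "sqrt 2 < (3/2::real)" by (rule real_less_lsqrt) (simp_all add: power2_eq_square)
  ultimately have w: "2/5 < w" "w < 1/2" by (simp_all add: w_def)
  have ar: "alpha_r lam gam = gam / (2 + gam)" using lam gam by (intro alpha_r_eq)
  \<comment> \<open>For \<open>x = s * lam\<close>, which is nonnegative,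
    \<open>2 * x + x^2 \<le> 1\<close> amounts to \<open>x \<le> w\<close>.\<close>
  have small: "alpha2 lam gam = 1 - (1 - s * (gam * lam))\<^sup>2"
    if "2 * lam \<le> w * (gam * lam + (1 - lam))"
  proof (rule alpha2_small_lam[OF lam(1) gam lt s_def])
    have "s * lam \<le> w" using that d lam by (simp add: s_def field_simps)
    moreover have "0 \<le> s * lam" using d lam by (simp add: s_def)
    ultimately have "s * lam \<le> w" "(s * lam)\<^sup>2 \<le> w\<^sup>2" by (auto intro: power_mono)
    then show "2 * (s * lam) + (s * lam)\<^sup>2 \<le> 1" using w2 by simp
  qed
  have "alpha2 lam gam \<ge> alpha_r lam gam" if "l0 \<le> lam"
  proof -
    \<comment> \<open>The cases locate \<open>lam / w\<close> relative to the midpoint and the right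
      end of \<open>[d, 1 - lam]\<close>.\<close>
    consider "2 * lam \<le> w * (gam * lam + (1 - lam))"
      | "w * (gam * lam + (1 - lam)) \<le> 2 * lam" "lam \<le> w * (1 - lam)"
      | "w * (1 - lam) \<le> lam" by linarith
    then show ?thesis
    proof cases
      case 1
      then show ?thesis using small ar that small_lam_gap_threshold(1)[OF t(1) gt gam lam s_def]
        by (simp add: l0_def)
    next
      case 2
      \<comment> \<open>After division by \<open>gam\<close>, the gap is at least
        \<open>2 * w - w^2 = 4 * w - 1 > 3/5\<close>, while the ridge gap is at most 1/2.\<close>
      have "w\<^sup>2 * gam \<le> w\<^sup>2 * 1" using gam by (intro mult_left_mono) auto
      then have "1/2 \<le> 2 * w - w\<^sup>2 * gam" using w w2 by linarith
      moreover have "1 / (2 + gam) \<le> 1/2" using gam by (simp add: field_simps)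
      ultimately have "1 / (2 + gam) \<le> 2 * w - w\<^sup>2 * gam" by linarith
      then have "gam * (1 / (2 + gam)) \<le> gam * (2 * w - w\<^sup>2 * gam)"
        using gam by (intro mult_left_mono) auto
      also have "\<dots> = alpha2 lam gam"
        using alpha2_intermediate_lam[OF lam(1) gam lt _ w2 2] w
        by (simp add: algebra_simps power2_eq_square)
      finally show ?thesis using ar by simp
    next
      case 3
      \<comment> \<open>With \<open>q = lam / (1 - lam)\<close>, \<open>q \<ge> w\<close> gives
        \<open>q^2 + 2 * q \<ge> 1\<close>, which is this inequality with denominators
        cleared.\<close>
      have "1 - 4 * lam + 2 * lam\<^sup>2 \<le> 0"
      proof -
        have "w * (1 - lam) * (w * (1 - lam)) \<le> lam * lam" using 3 w lam by (intro mult_mono) auto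
        moreover have "w * (1 - lam) * (w * (1 - lam)) = (1 - lam)\<^sup>2 - 2 * (w * (1 - lam) * (1 - lam))"
        proof -
          have "w\<^sup>2 = 1 - 2 * w" using w2 by simp
          moreover have "w * (1 - lam) * (w * (1 - lam)) = w\<^sup>2 * (1 - lam)\<^sup>2"
            by (simp add: power2_eq_square)
          ultimately show ?thesis by (simp only:) (simp add: algebra_simps power2_eq_square)
        qed
        moreover have "w * (1 - lam) * (1 - lam) \<le> lam * (1 - lam)"
          using 3 lam by (intro mult_right_mono) auto
        ultimately have "(1 - lam)\<^sup>2 \<le> lam * lam + 2 * (lam * (1 - lam))" by linarith
        then show ?thesis by (simp add: algebra_simps power2_eq_square)
      qed
      then have a2: "alpha2 lam gam = gam * (1 - (1 + gam) * (lam * (1 - 2 * lam) / (1 - lam)))"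
        by (rule alpha2_large_lam[OF lam gam])
      \<comment> \<open>The bound 1/3 is the infimum of \<open>1 / (2 + gam)\<close>; cleared of
        denominators it reads \<open>6 * lam^2 - 4 * lam + 1 \<ge> 0\<close>.\<close>
      have "0 \<le> 6 * (lam - 1/3)\<^sup>2" by simp
      then have "lam * (1 - 2 * lam) / (1 - lam) \<le> 1/3"
        using lam by (simp add: field_simps power2_eq_square)
      also have "\<dots> \<le> 1 / (2 + gam)" using gam by (simp add: field_simps)
      finally have "(1 + gam) * (lam * (1 - 2 * lam) / (1 - lam)) \<le> (1 + gam) * (1 / (2 + gam))"
        using gam by (intro mult_left_mono) auto
      also have "\<dots> = 1 - 1 / (2 + gam)" using gam by (simp add: field_simps)
      finally have "gam * (1 / (2 + gam)) \<le> alpha2 lam gam"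
        unfolding a2 using gam by (intro mult_left_mono) auto
      then show ?thesis using ar by simp
    qed
  qed
  moreover have "alpha2 lam gam \<le> alpha_r lam gam" if "lam < l0"
  proof -
    \<comment> \<open>Below the threshold only the first regime occurs: \<open>l0\<close> is at most
      its value 1/9 at \<open>t = 1\<close>.\<close>
    have "l0 \<le> 1/9"
    proof -
      have "t\<^sup>2 \<le> t" "t \<le> 1" using t by (auto simp: power2_eq_square mult_left_le)
      then have "9 * t\<^sup>2 \<le> 3 * t\<^sup>2 + 4 * t + 2" by linarith
      moreover have "0 < 3 * t\<^sup>2 + 4 * t + 2" using t by (simp add: add_pos_pos)
      ultimately show ?thesis by (simp add: l0_def field_simps)
    qed
    then have l9: "lam < 1/9" using that by simp
    have "2 * lam \<le> 2/5 * (8/9)" using l9 by simp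
    also have "\<dots> \<le> w * (gam * lam + (1 - lam))" using w l9 d by (intro mult_mono) auto
    finally show ?thesis using small ar that small_lam_gap_threshold(2)[OF t(1) gt gam lam s_def]
      by (simp add: l0_def)
  qed
  ultimately show ?thesis unfolding threshold_eq[OF t(1) gt] l0_def[symmetric] by auto
qed

end
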